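(* For every integer $n\ge 1$, $\chi_{la}(nC_4(8,2))=3$.
   Context: For a graph $G=(V,E)$ with $|E|=m$ and no isolated vertices, a local antimagic labeling is a bijection $f:E\to\{1,\dots,m\}$ such that $f^+(u)\ne f^+(v)$ for every edge $uv$, where $f^+(x)=\sum f(e)$ over all edges $e$ incident to $x$. The local antimagic chromatic number $\chi_{la}(G)$ is the minimum, over all local antimagic labelings $f$ of $G$, of the number of distinct values taken by $f^+$ (also for disconnected graphs). $nG$ is the disjoint union of $n$ copies of $G$. $C_4(8,2)$ is the graph with vertex set $\{u_i,v_i:1\le i\le 8\}$ and edges $u_iu_{i+1}$, $v_iv_{i+1}$ ($1\le i\le 8$, indices mod 8) and $u_{2j}v_{2j}$ ($1\le j\le 4$); i.e., the prism $C_8\times P_2$ with the four rungs $u_{2j-1}v_{2j-1}$ deleted. *)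

theory Defs
  imports Main
begin

text \<open>
  A finite simple graph is a pair of a vertex set and a set of edges, each edge being the
  two-element set of its endpoints.
\<close>

type_synonym 'a graph = "'a set \<times> 'a set set"

abbreviation verts :: "'a graph \<Rightarrow> 'a set" where
  "verts \<equiv> fst"

abbreviation edges :: "'a graph \<Rightarrow> 'a set set" where
  "edges \<equiv> snd"

definition simple_graph :: "'a graph \<Rightarrow> bool" where
  "simple_graph G \<longleftrightarrow> finite (verts G) \<and> (\<forall>e\<in>edges G. e \<subseteq> verts G \<and> card e = 2)"

definition no_isolated_vertices :: "'a graph \<Rightarrow> bool" where
  "no_isolated_vertices G \<longleftrightarrow> (\<forall>x\<in>verts G. \<exists>e\<in>edges G. x \<in> e)"

definition induced_label :: "'a graph \<Rightarrow> ('a set \<Rightarrow> nat) \<Rightarrow> 'a \<Rightarrow> nat" where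
  "induced_label G f x = (\<Sum>e\<in>{e \<in> edges G. x \<in> e}. f e)"

definition local_antimagic_labeling :: "'a graph \<Rightarrow> ('a set \<Rightarrow> nat) \<Rightarrow> bool" where
  "local_antimagic_labeling G f \<longleftrightarrow>
     bij_betw f (edges G) {1..card (edges G)} \<and>
     (\<forall>u v. {u, v} \<in> edges G \<longrightarrow> induced_label G f u \<noteq> induced_label G f v)"

text \<open>
  The infimum of a nonempty set of natural numbers is its minimum; the infimum of the empty set
  is 0, so a positive value entails that a local antimagic labeling exists.
\<close>

definition local_antimagic_chromatic_number :: "'a graph \<Rightarrow> nat" where
  "local_antimagic_chromatic_number G =
     Inf {card (induced_label G f ` verts G) | f. local_antimagic_labeling G f}"

definition disjoint_copies :: "nat \<Rightarrow> 'a graph \<Rightarrow> (nat \<times> 'a) graph" where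
  "disjoint_copies n G =
     ({..<n} \<times> verts G, {Pair i ` e | i e. i < n \<and> e \<in> edges G})"

datatype prism_vertex = U nat | V nat

text \<open>For \<open>1 \<le> i \<le> 8\<close>, the index following \<open>i\<close> cyclically is \<open>i mod 8 + 1\<close>.\<close>

definition C4_8_2 :: "prism_vertex graph" where
  "C4_8_2 =
     (U ` {1..8} \<union> V ` {1..8},
      {{U i, U (i mod 8 + 1)} | i. i \<in> {1..8}} \<union>
      {{V i, V (i mod 8 + 1)} | i. i \<in> {1..8}} \<union>
      {{U (2 * j), V (2 * j)} | j. j \<in> {1..4}})"

lemma edges_C4_8_2:
  "edges C4_8_2 =
     {{U 1, U 2}, {U 2, U 3}, {U 3, U 4}, {U 4, U 5},
      {U 5, U 6}, {U 6, U 7}, {U 7, U 8}, {U 8, U 1},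
      {V 1, V 2}, {V 2, V 3}, {V 3, V 4}, {V 4, V 5},
      {V 5, V 6}, {V 6, V 7}, {V 7, V 8}, {V 8, V 1},
      {U 2, V 2}, {U 4, V 4}, {U 6, V 6}, {U 8, V 8}}"
proof -
  have I: "{1..8} = {1, 2, 3, 4, 5, 6, 7, 8 :: nat}" "{1..4} = {1, 2, 3, 4 :: nat}"
    by auto
  have "edges C4_8_2 =
      (\<lambda>i. {U i, U (i mod 8 + 1)}) ` {1..8} \<union>
      (\<lambda>i. {V i, V (i mod 8 + 1)}) ` {1..8} \<union>
      (\<lambda>j. {U (2 * j), V (2 * j)}) ` {1..4}"
    unfolding C4_8_2_def snd_conv by (simp only: Setcompr_eq_image Collect_mem_eq)
  then show ?thesis
    unfolding I by (simp add: insert_commute del: One_nat_def)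
qed

lemma simple_graph_C4_8_2: "simple_graph C4_8_2"
  unfolding simple_graph_def edges_C4_8_2 by (simp add: C4_8_2_def)

lemma no_isolated_vertices_C4_8_2: "no_isolated_vertices C4_8_2"
proof -
  have "{1..8} = {1, 2, 3, 4, 5, 6, 7, 8 :: nat}"
    by auto
  then have "verts C4_8_2 = U ` {1, 2, 3, 4, 5, 6, 7, 8} \<union> V ` {1, 2, 3, 4, 5, 6, 7, 8}"
    by (simp only: C4_8_2_def fst_conv)
  then show ?thesis
    unfolding no_isolated_vertices_def edges_C4_8_2 by simp
qed

lemma card_edges_C4_8_2: "card (edges C4_8_2) = 20"
  unfolding edges_C4_8_2 by (simp add: doubleton_eq_iff card_insert_if)

lemma simple_graph_disjoint_copies:
  "simple_graph G \<Longrightarrow> simple_graph (disjoint_copies n G)"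
  unfolding simple_graph_def disjoint_copies_def
  by (auto simp: card_image inj_on_def)

lemma no_isolated_vertices_disjoint_copies:
  assumes "no_isolated_vertices G"
  shows "no_isolated_vertices (disjoint_copies n G)"
  unfolding no_isolated_vertices_def
proof
  fix y assume "y \<in> verts (disjoint_copies n G)"
  then obtain i x where y: "y = (i, x)" "i < n" "x \<in> verts G"
    by (auto simp: disjoint_copies_def)
  with assms obtain e where "e \<in> edges G" "x \<in> e"
    by (auto simp: no_isolated_vertices_def)
  with y show "\<exists>e\<in>edges (disjoint_copies n G). y \<in> e"
    by (intro bexI[of _ "Pair i ` e"]) (auto simp: disjoint_copies_def)
qed

end

theory Submission
  imports Defs
begin

text \<open>
  Two colours are impossible: a component is connected and bipartite with eight vertices on each
  side, so each side would be monochromatic; but both sides carry the total label sum of the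
  component, which forces the two colours to coincide.

  For three colours, every edge of the component gets in copy \<open>i\<close> a label that is affine in \<open>i\<close>
  with slope \<open>\<plusminus>1\<close> or \<open>\<plusminus>2\<close>. The slopes cancel at every vertex, so that the colours do not depend
  on the copy. Edges of slope \<open>\<plusminus>1\<close> fill intervals of \<open>n\<close> labels, and pairs of edges of equal slope
  \<open>\<plusminus>2\<close> fill intervals of \<open>2 * n\<close> labels, one with the odd and the other with the even offsets.
\<close>

section \<open>Edges and vertex sums of disjoint copies\<close>

lemma induced_label_eq_sum_if:
  assumes "finite (edges G)"
  shows "induced_label G f x = (\<Sum>e\<in>edges G. if x \<in> e then f e else 0)"
  using assms by (simp add: induced_label_def sum.inter_filter)

lemma inj_on_copy_edge: "inj_on (\<lambda>(i, e). Pair i ` e) (I \<times> (E - {{}}))"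
proof (rule inj_onI)
  fix p q
  assume "p \<in> I \<times> (E - {{}})" "q \<in> I \<times> (E - {{}})"
    and eq: "(case p of (i, e) \<Rightarrow> Pair i ` e) = (case q of (i, e) \<Rightarrow> Pair i ` e)"
  then show "p = q"
    using arg_cong[OF eq, of "image fst"] arg_cong[OF eq, of "image snd"]
    by (cases p; cases q) (auto simp: image_image image_constant_conv split: if_splits)
qed

lemma edges_disjoint_copies:
  "edges (disjoint_copies n G) = (\<lambda>(i, e). Pair i ` e) ` ({..<n} \<times> edges G)"
  by (auto simp: disjoint_copies_def)

lemma copy_edge_in_disjoint_copies:
  "i < n \<Longrightarrow> e \<in> edges G \<Longrightarrow> Pair i ` e \<in> edges (disjoint_copies n G)"
  by (auto simp: disjoint_copies_def)

lemma card_edges_disjoint_copies: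
  assumes "{} \<notin> edges G"
  shows "card (edges (disjoint_copies n G)) = n * card (edges G)"
  unfolding edges_disjoint_copies using inj_on_copy_edge[of "{..<n}" "edges G"] assms
  by (simp add: card_image card_cartesian_product)

lemma induced_label_disjoint_copies:
  assumes "i < n"
  shows "induced_label (disjoint_copies n G) f (i, x) = induced_label G (\<lambda>e. f (Pair i ` e)) x"
proof -
  have "{e \<in> edges (disjoint_copies n G). (i, x) \<in> e} = (`) (Pair i) ` {e \<in> edges G. x \<in> e}"
    using assms by (auto simp: disjoint_copies_def)
  moreover have "inj_on ((`) (Pair i)) {e \<in> edges G. x \<in> e}"
    by (auto simp: inj_on_def inj_image_eq_iff)
  ultimately show ?thesis
    by (simp add: induced_label_def sum.reindex)
qed

section \<open>One component needs three colours\<close>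

lemma verts_C4_8_2:
  "verts C4_8_2 = {U 1, U 2, U 3, U 4, U 5, U 6, U 7, U 8, V 1, V 2, V 3, V 4, V 5, V 6, V 7, V 8}"
proof -
  have "{1..8} = {1, 2, 3, 4, 5, 6, 7, 8 :: nat}"
    by auto
  then show ?thesis
    by (simp add: C4_8_2_def insert_commute del: One_nat_def)
qed

lemma sum_edges_C4_8_2:
  fixes h :: "prism_vertex set \<Rightarrow> nat"
  shows "(\<Sum>e\<in>edges C4_8_2. h e) =
     h {U 1, U 2} + h {U 2, U 3} + h {U 3, U 4} + h {U 4, U 5} +
     h {U 5, U 6} + h {U 6, U 7} + h {U 7, U 8} + h {U 8, U 1} +
     h {V 1, V 2} + h {V 2, V 3} + h {V 3, V 4} + h {V 4, V 5} +
     h {V 5, V 6} + h {V 6, V 7} + h {V 7, V 8} + h {V 8, V 1} +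
     h {U 2, V 2} + h {U 4, V 4} + h {U 6, V 6} + h {U 8, V 8}"
  unfolding edges_C4_8_2 by (simp add: doubleton_eq_iff add.assoc del: One_nat_def)

lemma induced_label_C4_8_2:
  "induced_label C4_8_2 f x = (\<Sum>e\<in>edges C4_8_2. if x \<in> e then f e else 0)"
  by (rule induced_label_eq_sum_if) (simp add: edges_C4_8_2)

text \<open>Arbitrary edge weights are allowed, so that the bound applies to the restriction of a
  labeling of all copies to a single one.\<close>

lemma three_le_card_colours:
  assumes proper: "\<And>x y. {x, y} \<in> edges C4_8_2 \<Longrightarrow>
    induced_label C4_8_2 f x \<noteq> induced_label C4_8_2 f y"
  shows "3 \<le> card (induced_label C4_8_2 f ` verts C4_8_2)"
proof (rule ccontr)
  define g where "g = induced_label C4_8_2 f"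
  assume "\<not> ?thesis"
  moreover have "finite (g ` verts C4_8_2)"
    by (simp add: verts_C4_8_2)
  moreover have "g (U 1) \<noteq> g (U 2)"
    unfolding g_def by (intro proper) (simp add: edges_C4_8_2)
  moreover have "g (U 1) \<in> g ` verts C4_8_2" "g (U 2) \<in> g ` verts C4_8_2"
    by (simp_all add: verts_C4_8_2)
  ultimately have "g ` verts C4_8_2 = {g (U 1), g (U 2)}"
    using card_seteq[of "g ` verts C4_8_2" "{g (U 1), g (U 2)}"] by (simp add: g_def)
  then have two: "g x = g (U 1) \<or> g x = g (U 2)" if "x \<in> verts C4_8_2" for x
    using that by blast
  \<comment> \<open>With only two colours, crossing an edge swaps them. A walk from
    \<open>U 1\<close> and \<open>U 2\<close> then determines the colour of every vertex.\<close>
  have step: "g y = g (U 2)" if "g x = g (U 1)" "{x, y} \<in> edges C4_8_2" "y \<in> verts C4_8_2" for x y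
    using that two[of y] proper[of x y] by (auto simp: g_def)
  have step': "g y = g (U 1)" if "g x = g (U 2)" "{x, y} \<in> edges C4_8_2" "y \<in> verts C4_8_2" for x y
    using that two[of y] proper[of x y] by (auto simp: g_def)
  note E = edges_C4_8_2 verts_C4_8_2
  have c: "g (U 3) = g (U 1)" "g (V 2) = g (U 1)"
    using step'[of "U 2"] by (simp_all add: E)
  have d: "g (U 4) = g (U 2)" "g (V 1) = g (U 2)" "g (V 3) = g (U 2)" "g (U 8) = g (U 2)"
    using step[of "U 3" "U 4"] step[of "V 2" "V 1"] step[of "V 2" "V 3"] step[of "U 1" "U 8"] c
    by (simp_all add: E insert_commute)
  have c': "g (U 5) = g (U 1)" "g (V 4) = g (U 1)" "g (V 8) = g (U 1)" "g (U 7) = g (U 1)"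
    using step'[of "U 4" "U 5"] step'[of "V 3" "V 4"] step'[of "U 8" "V 8"] step'[of "U 8" "U 7"] d
    by (simp_all add: E insert_commute)
  have d': "g (U 6) = g (U 2)" "g (V 5) = g (U 2)" "g (V 7) = g (U 2)"
    using step[of "U 5" "U 6"] step[of "V 4" "V 5"] step[of "V 8" "V 7"] c'
    by (simp_all add: E insert_commute)
  have c'': "g (V 6) = g (U 1)"
    using step'[of "U 6" "V 6"] d' by (simp add: E)
  \<comment> \<open>Every edge has exactly one end in each bipartition class, so both sides count
    each edge label once.\<close>
  have "g (U 1) + g (U 3) + g (U 5) + g (U 7) + g (V 2) + g (V 4) + g (V 6) + g (V 8) =
        g (U 2) + g (U 4) + g (U 6) + g (U 8) + g (V 1) + g (V 3) + g (V 5) + g (V 7)"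
    unfolding g_def induced_label_C4_8_2 sum_edges_C4_8_2 by simp
  then show False
    using c c' c'' d d' \<open>g (U 1) \<noteq> g (U 2)\<close> by simp
qed

section \<open>The labeling with three colours\<close>

definition copy_label :: "nat \<Rightarrow> nat \<Rightarrow> prism_vertex set \<Rightarrow> nat" where
  "copy_label n i e = the (map_of
     [({U 1, U 2}, 8 * n + 1 + 2 * i), ({U 2, U 3}, 15 * n - i),
      ({U 3, U 4}, 5 * n + 1 + i), ({U 4, U 5}, 12 * n - 1 - 2 * i),
      ({U 5, U 6}, 8 * n + 2 + 2 * i), ({U 6, U 7}, 3 * n - i),
      ({U 7, U 8}, 17 * n + 1 + i), ({U 8, U 1}, 12 * n - 2 * i),
      ({V 1, V 2}, 3 * n + 2 + 2 * i), ({V 2, V 3}, 20 * n - i),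
      ({V 3, V 4}, 1 + i), ({V 4, V 5}, 17 * n - 2 * i),
      ({V 5, V 6}, 3 * n + 1 + 2 * i), ({V 6, V 7}, 8 * n - i),
      ({V 7, V 8}, 12 * n + 1 + i), ({V 8, V 1}, 17 * n - 1 - 2 * i),
      ({U 2, V 2}, 7 * n - i), ({U 4, V 4}, 13 * n + 1 + i),
      ({U 6, V 6}, 19 * n - i), ({U 8, V 8}, n + 1 + i)] e)"

lemma copy_label_simps:
  "copy_label n i {U 1, U 2} = 8 * n + 1 + 2 * i"
  "copy_label n i {U 2, U 3} = 15 * n - i"
  "copy_label n i {U 3, U 4} = 5 * n + 1 + i"
  "copy_label n i {U 4, U 5} = 12 * n - 1 - 2 * i"
  "copy_label n i {U 5, U 6} = 8 * n + 2 + 2 * i"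
  "copy_label n i {U 6, U 7} = 3 * n - i"
  "copy_label n i {U 7, U 8} = 17 * n + 1 + i"
  "copy_label n i {U 8, U 1} = 12 * n - 2 * i"
  "copy_label n i {V 1, V 2} = 3 * n + 2 + 2 * i"
  "copy_label n i {V 2, V 3} = 20 * n - i"
  "copy_label n i {V 3, V 4} = 1 + i"
  "copy_label n i {V 4, V 5} = 17 * n - 2 * i"
  "copy_label n i {V 5, V 6} = 3 * n + 1 + 2 * i"
  "copy_label n i {V 6, V 7} = 8 * n - i"
  "copy_label n i {V 7, V 8} = 12 * n + 1 + i"
  "copy_label n i {V 8, V 1} = 17 * n - 1 - 2 * i"
  "copy_label n i {U 2, V 2} = 7 * n - i"
  "copy_label n i {U 4, V 4} = 13 * n + 1 + i"
  "copy_label n i {U 6, V 6} = 19 * n - i"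
  "copy_label n i {U 8, V 8} = n + 1 + i"
  by (simp_all add: copy_label_def doubleton_eq_iff del: One_nat_def)

text \<open>The slopes in \<open>i\<close> are opposite at a vertex of degree 2 and are 2, -1, -1 up
  to a common sign at one of degree 3, so \<open>i\<close> cancels. The bound \<open>i < n\<close>
  keeps the subtractions from truncating. The constants are arranged so that the ends of each rung
  get \<open>30 * n + 1\<close> and \<open>30 * n + 2\<close>.\<close>

lemma induced_label_copy_label:
  assumes "i < n" "x \<in> verts C4_8_2"
  shows "induced_label C4_8_2 (copy_label n i) x =
    (if x \<in> {U 2, U 4, V 6, V 8} then 30 * n + 1
     else if x \<in> {U 6, U 8, V 2, V 4} then 30 * n + 2
     else 20 * n + 1)"
  using assms unfolding induced_label_C4_8_2 sum_edges_C4_8_2 copy_label_simps verts_C4_8_2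
  by (elim insertE) (simp_all del: One_nat_def)

text \<open>On an edge of a copy, the first projection is the singleton of the copy index and the
  second is the underlying edge.\<close>

definition copies_label :: "nat \<Rightarrow> (nat \<times> prism_vertex) set \<Rightarrow> nat" where
  "copies_label n e = copy_label n (the_elem (fst ` e)) (snd ` e)"

lemma copies_label_Pair: "e \<noteq> {} \<Longrightarrow> copies_label n (Pair i ` e) = copy_label n i e"
  by (simp add: copies_label_def image_image image_constant_conv)

lemma empty_notin_edges_C4_8_2: "{} \<notin> edges C4_8_2"
  by (simp add: edges_C4_8_2)

lemma induced_label_copies_label:
  assumes "i < n"
  shows "induced_label (disjoint_copies n C4_8_2) (copies_label n) (i, x) =
    induced_label C4_8_2 (copy_label n i) x"
  unfolding induced_label_disjoint_copies[OF assms] unfolding induced_label_def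
  by (intro sum.cong refl copies_label_Pair) auto

section \<open>Tiling the label range by intervals\<close>

lemma block_increasing:
  fixes a b k n :: nat
  assumes "a < k \<and> k \<le> b" "b = a + n"
  shows "\<exists>i<n. k = a + 1 + i"
  using assms by presburger

lemma block_decreasing:
  fixes a b k n :: nat
  assumes "a < k \<and> k \<le> b" "b = a + n"
  shows "\<exists>i<n. k = b - i"
  using assms by presburger

lemma block_increasing_double:
  fixes a b k n :: nat
  assumes "a < k \<and> k \<le> b" "b = a + 2 * n"
  shows "(\<exists>i<n. k = a + 1 + 2 * i) \<or> (\<exists>i<n. k = a + 2 + 2 * i)"
proof -
  \<comment> \<open>Two consecutive labels share one \<open>i\<close>; the parity of
    \<open>k - a\<close> selects the disjunct.\<close>
  define i where "i = (k - a - 1) div 2"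
  have "i < n" "k = a + 1 + 2 * i \<or> k = a + 2 + 2 * i"
    using assms unfolding i_def by linarith+
  then show ?thesis
    by blast
qed

lemma block_decreasing_double:
  fixes a b k n :: nat
  assumes "a < k \<and> k \<le> b" "b = a + 2 * n"
  shows "(\<exists>i<n. k = b - 2 * i) \<or> (\<exists>i<n. k = b - 1 - 2 * i)"
proof -
  define i where "i = (b - k) div 2"
  have "i < n" "k = b - 2 * i \<or> k = b - 1 - 2 * i"
    using assms unfolding i_def by linarith+
  then show ?thesis
    by blast
qed

text \<open>Twelve intervals of length \<open>n\<close> serve one edge each, and four of length
  \<open>2 * n\<close> serve two edges each, which accounts for all 20 edges and all
  \<open>20 * n\<close> labels.\<close>

lemma copy_label_surj:
  assumes "k \<in> {1..20 * n}"
  shows "\<exists>i<n. \<exists>e\<in>edges C4_8_2. k = copy_label n i e"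
proof -
  have hit: ?thesis if "\<exists>i<n. k = copy_label n i e" "e \<in> edges C4_8_2" for e
    using that by blast
  note simps = copy_label_simps edges_C4_8_2
  have "0 < k" "k \<le> 20 * n"
    using assms by auto
  then consider
    "0 < k \<and> k \<le> n" | "n < k \<and> k \<le> 2 * n" | "2 * n < k \<and> k \<le> 3 * n" |
    "3 * n < k \<and> k \<le> 5 * n" | "5 * n < k \<and> k \<le> 6 * n" | "6 * n < k \<and> k \<le> 7 * n" |
    "7 * n < k \<and> k \<le> 8 * n" | "8 * n < k \<and> k \<le> 10 * n" | "10 * n < k \<and> k \<le> 12 * n" |
    "12 * n < k \<and> k \<le> 13 * n" | "13 * n < k \<and> k \<le> 14 * n" | "14 * n < k \<and> k \<le> 15 * n" |
    "15 * n < k \<and> k \<le> 17 * n" | "17 * n < k \<and> k \<le> 18 * n" | "18 * n < k \<and> k \<le> 19 * n" |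
    "19 * n < k \<and> k \<le> 20 * n"
    \<comment> \<open>Once \<open>a < k\<close> is read as the negation of \<open>k \<le> a\<close>,
      the case split is purely propositional: take the first listed upper end that bounds
      \<open>k\<close>.\<close>
    unfolding not_le[symmetric] by blast
  then show ?thesis
  proof cases
    case 1
    show ?thesis using block_increasing[OF 1] hit[of "{V 3, V 4}"]
      by (auto simp: simps simp del: One_nat_def)
  next
    case 2
    show ?thesis using block_increasing[OF 2] hit[of "{U 8, V 8}"]
      by (auto simp: simps simp del: One_nat_def)
  next
    case 3
    show ?thesis using block_decreasing[OF 3] hit[of "{U 6, U 7}"]
      by (auto simp: simps simp del: One_nat_def)
  next
    case 4
    show ?thesis using block_increasing_double[OF 4] hit[of "{V 5, V 6}"] hit[of "{V 1, V 2}"]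
      by (auto simp: simps simp del: One_nat_def)
  next
    case 5
    show ?thesis using block_increasing[OF 5] hit[of "{U 3, U 4}"]
      by (auto simp: simps simp del: One_nat_def)
  next
    case 6
    show ?thesis using block_decreasing[OF 6] hit[of "{U 2, V 2}"]
      by (auto simp: simps simp del: One_nat_def)
  next
    case 7
    show ?thesis using block_decreasing[OF 7] hit[of "{V 6, V 7}"]
      by (auto simp: simps simp del: One_nat_def)
  next
    case 8
    show ?thesis using block_increasing_double[OF 8] hit[of "{U 1, U 2}"] hit[of "{U 5, U 6}"]
      by (auto simp: simps simp del: One_nat_def)
  next
    case 9
    show ?thesis using block_decreasing_double[OF 9] hit[of "{U 8, U 1}"] hit[of "{U 4, U 5}"]
      by (auto simp: simps simp del: One_nat_def)
  next
    case 10
    show ?thesis using block_increasing[OF 10] hit[of "{V 7, V 8}"]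
      by (auto simp: simps simp del: One_nat_def)
  next
    case 11
    show ?thesis using block_increasing[OF 11] hit[of "{U 4, V 4}"]
      by (auto simp: simps simp del: One_nat_def)
  next
    case 12
    show ?thesis using block_decreasing[OF 12] hit[of "{U 2, U 3}"]
      by (auto simp: simps simp del: One_nat_def)
  next
    case 13
    show ?thesis using block_decreasing_double[OF 13] hit[of "{V 4, V 5}"] hit[of "{V 8, V 1}"]
      by (auto simp: simps simp del: One_nat_def)
  next
    case 14
    show ?thesis using block_increasing[OF 14] hit[of "{U 7, U 8}"]
      by (auto simp: simps simp del: One_nat_def)
  next
    case 15
    show ?thesis using block_decreasing[OF 15] hit[of "{U 6, V 6}"]
      by (auto simp: simps simp del: One_nat_def)
  next
    case 16
    show ?thesis using block_decreasing[OF 16] hit[of "{V 2, V 3}"]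
      by (auto simp: simps simp del: One_nat_def)
  qed
qed

section \<open>The chromatic number of the copies\<close>

lemma local_antimagic_labeling_copies_label:
  "local_antimagic_labeling (disjoint_copies n C4_8_2) (copies_label n)"
proof -
  let ?G = "disjoint_copies n C4_8_2"
  have card: "card (edges ?G) = 20 * n"
    by (simp add: card_edges_disjoint_copies empty_notin_edges_C4_8_2 card_edges_C4_8_2)
  have fin: "finite (edges ?G)"
    by (simp add: edges_disjoint_copies edges_C4_8_2)
  have "{1..20 * n} \<subseteq> copies_label n ` edges ?G"
  proof
    fix k assume "k \<in> {1..20 * n}"
    then obtain i e where ie: "i < n" "e \<in> edges C4_8_2" "k = copy_label n i e"
      using copy_label_surj by blast
    then have "k = copies_label n (Pair i ` e)"
      using empty_notin_edges_C4_8_2 by (metis copies_label_Pair)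
    moreover have "Pair i ` e \<in> edges ?G"
      using ie by (simp add: copy_edge_in_disjoint_copies)
    ultimately show "k \<in> copies_label n ` edges ?G"
      by (rule image_eqI)
  qed
  \<comment> \<open>There are as many edges as labels, so surjectivity gives both the exact image
    and injectivity.\<close>
  then have img: "copies_label n ` edges ?G = {1..20 * n}"
    using card_image_le[OF fin, of "copies_label n"] card fin
    by (intro card_seteq[symmetric]) auto
  then have "bij_betw (copies_label n) (edges ?G) {1..card (edges ?G)}"
    using fin card by (auto simp: bij_betw_def intro: eq_card_imp_inj_on)
  moreover have "induced_label ?G (copies_label n) u \<noteq> induced_label ?G (copies_label n) v"
    if uv_edge: "{u, v} \<in> edges ?G" for u v
  proof -
    obtain i e where i: "i < n" and e: "e \<in> edges C4_8_2" and uv: "{u, v} = Pair i ` e"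
      using uv_edge by (auto simp: edges_disjoint_copies)
    have "u \<in> Pair i ` e" "v \<in> Pair i ` e"
      unfolding uv[symmetric] by simp_all
    then obtain x y where xy: "u = (i, x)" "v = (i, y)"
      by blast
    have e': "e = {x, y}"
      using arg_cong[OF uv, of "image snd"] by (simp add: xy image_image)
    have v: "x \<in> verts C4_8_2" "y \<in> verts C4_8_2"
      using e simple_graph_C4_8_2 by (auto simp: simple_graph_def e')
    \<comment> \<open>Cycle edges join colour \<open>20 * n + 1\<close> to one of the two larger
      colours, and these differ only for positive \<open>n\<close>.\<close>
    have "n \<noteq> 0"
      using i by simp
    then show ?thesis
      using e unfolding xy e' induced_label_copies_label[OF i]
        induced_label_copy_label[OF i v(1)] induced_label_copy_label[OF i v(2)] edges_C4_8_2
      by (elim insertE) (auto simp: doubleton_eq_iff simp del: One_nat_def)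
  qed
  ultimately show ?thesis
    by (auto simp: local_antimagic_labeling_def)
qed

text \<open>Copy 0 exists since \<open>n \<ge> 1\<close>, and the vertex sums in it depend only on
  its own edges, so it already shows three colours.\<close>

lemma three_le_card_colours_copies:
  assumes "n \<ge> 1" "local_antimagic_labeling (disjoint_copies n C4_8_2) f"
  shows "3 \<le> card (induced_label (disjoint_copies n C4_8_2) f ` verts (disjoint_copies n C4_8_2))"
proof -
  let ?G = "disjoint_copies n C4_8_2" and ?g = "induced_label C4_8_2 (\<lambda>e. f (Pair 0 ` e))"
  have g: "induced_label ?G f (0, x) = ?g x" for x
    using assms by (simp add: induced_label_disjoint_copies)
  have "?g x \<noteq> ?g y" if "{x, y} \<in> edges C4_8_2" for x y
  proof -
    have "{(0, x), (0, y)} \<in> edges ?G"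
      using copy_edge_in_disjoint_copies[OF _ that, of 0 n] assms(1) by simp
    then show ?thesis
      using assms(2) unfolding local_antimagic_labeling_def g[symmetric] by blast
  qed
  then have "3 \<le> card (?g ` verts C4_8_2)"
    by (rule three_le_card_colours)
  also have "\<dots> \<le> card (induced_label ?G f ` verts ?G)"
  proof (rule card_mono)
    show "finite (induced_label ?G f ` verts ?G)"
      by (simp add: disjoint_copies_def verts_C4_8_2)
    show "?g ` verts C4_8_2 \<subseteq> induced_label ?G f ` verts ?G"
      using assms(1) by (auto simp: disjoint_copies_def g[symmetric])
  qed
  finally show ?thesis .
qed

theorem theorem3p1:
  fixes n :: nat
  assumes "n \<ge> 1"
  shows "local_antimagic_chromatic_number (disjoint_copies n C4_8_2) = 3"
proof -
  let ?G = "disjoint_copies n C4_8_2"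
  have "induced_label ?G (copies_label n) (i, x) \<in> {20 * n + 1, 30 * n + 1, 30 * n + 2}"
    if "i < n" "x \<in> verts C4_8_2" for i x
    unfolding induced_label_copies_label[OF that(1)] induced_label_copy_label[OF that] by simp
  then have "induced_label ?G (copies_label n) ` verts ?G \<subseteq> {20 * n + 1, 30 * n + 1, 30 * n + 2}"
    unfolding disjoint_copies_def[of n C4_8_2] fst_conv by (auto simp: disjoint_copies_def)
  then have "card (induced_label ?G (copies_label n) ` verts ?G) \<le> 3"
    by (rule order_trans[OF card_mono, rotated]) (simp_all add: card_insert_if)
  with three_le_card_colours_copies[OF assms local_antimagic_labeling_copies_label]
  have "3 = card (induced_label ?G (copies_label n) ` verts ?G)"
    by simp
  then show ?thesis
    unfolding local_antimagic_chromatic_number_def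
    using local_antimagic_labeling_copies_label three_le_card_colours_copies[OF assms]
    \<comment> \<open>The value 3 is attained by \<open>copies_label n\<close> and bounds every
      other count from below, so the infimum is a true minimum.\<close>
    by (intro cInf_eq_minimum) auto
qed

end
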